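(* Let $F\colon\mathsf{Dim}_+\to\mathsf{RadMeas}$ be a scaling-covariant homogeneous functor, and let $A(x,r)>0$ ($x>0$, $r\ge 0$) denote the coefficient in its homogeneous morphism densities, i.e. $F(r)\colon F(x)\to F(x+2r)$ is given by the density $u\mapsto A(x,r)\,u^r$. Then there exists a positive function $c\colon\mathbb{R}_{>0}\to(0,\infty)$ such that $$dF(x)(u)=c(x)\,u^{x/2-1}\,du\qquad\text{for every }x>0,$$ and the morphism part is forced by $$A(x,r)=\frac{c(x+2r)}{c(x)}\qquad\text{for every }x>0,\ r\ge 0.$$ Conversely, given any positive function $c\colon\mathbb{R}_{>0}\to(0,\infty)$, these two formulas (the first giving the object $F(x)$ for each $x>0$, the second giving the morphism $F(r)\colon F(x)\to F(x+2r)$ as the density $u\mapsto A(x,r)u^r$) define a scaling-covariant homogeneous functor $F\colon\mathsf{Dim}_+\to\mathsf{RadMeas}$.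
   Context: The category $\mathsf{Dim}_+$ (dimension-shift category) has as objects the positive real numbers $\mathbb{R}_{>0}$; there is exactly one morphism $x\to y$, denoted $r$, if $y=x+2r$ for some real $r\ge 0$, and no morphism $x\to y$ otherwise. Composition is addition of shift parameters: for $r\colon x\to x+2r$ and $s\colon x+2r\to x+2r+2s$, $s\circ r=r+s\colon x\to x+2(r+s)$. The identity at $x$ is $0\colon x\to x$. The category $\mathsf{RadMeas}$ has as objects the nonzero, locally finite positive Radon measures on $(0,\infty)$. A morphism $\mu\to\nu$ is a measurable function $h\colon(0,\infty)\to[0,\infty)$ with $d\nu=h\,d\mu$, i.e. $\nu(A)=\int_A h\,d\mu$ for every Borel $A\subset(0,\infty)$; two such functions $h,h'\colon\mu\to\nu$ are identified when $h=h'$ $\mu$-almost everywhere. Composition is pointwise multiplication of densities, and the identity is the constant function $1$. A functor $F\colon\mathsf{Dim}_+\to\mathsf{RadMeas}$ is called scaling-covariant homogeneous if both of the following hold. (SC) For every $x>0$, every $\phi\in C_c(\mathbb{R}_{>0})$ (continuous functions with compact support in $(0,\infty)$) and every $\lambda>0$, $$\int_0^\infty\phi(\lambda u)\,dF(x)(u)=\lambda^{-x/2}\int_0^\infty\phi(u)\,dF(x)(u).$$ (HD) There is a positive function $A\colon\{(x,r):x>0,\ r\ge 0\}\to(0,\infty)$ such that for every $x>0$ and $r\ge 0$ the morphism $F(r)\colon F(x)\to F(x+2r)$ is given by the density $h_{x,r}(u)=A(x,r)\,u^r$. *)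

theory Defs
  imports "HOL-Analysis.Analysis"
begin

section \<open>Categories and functors\<close>

text \<open>
  Hom-sets of different pairs of objects need not be disjoint, so composition carries its three
  objects: \<open>Comp C x y z g f\<close> is \<open>g \<circ> f\<close> for \<open>f : x \<rightarrow> y\<close> and \<open>g : y \<rightarrow> z\<close>. Likewise a functor acts
  on triples of source, target and morphism. Values off the objects and hom-sets are irrelevant.
\<close>

record ('o, 'm) cat =
  Obj :: "'o set"
  Hom :: "'o \<Rightarrow> 'o \<Rightarrow> 'm set"
  Id :: "'o \<Rightarrow> 'm"
  Comp :: "'o \<Rightarrow> 'o \<Rightarrow> 'o \<Rightarrow> 'm \<Rightarrow> 'm \<Rightarrow> 'm"

locale category =
  fixes C :: "('o, 'm) cat"
  assumes Id_in_Hom: "x \<in> Obj C \<Longrightarrow> Id C x \<in> Hom C x x"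
    and Comp_in_Hom: "\<lbrakk>x \<in> Obj C; y \<in> Obj C; z \<in> Obj C; f \<in> Hom C x y; g \<in> Hom C y z\<rbrakk>
      \<Longrightarrow> Comp C x y z g f \<in> Hom C x z"
    and Comp_Id_right: "\<lbrakk>x \<in> Obj C; y \<in> Obj C; f \<in> Hom C x y\<rbrakk> \<Longrightarrow> Comp C x x y f (Id C x) = f"
    and Comp_Id_left: "\<lbrakk>x \<in> Obj C; y \<in> Obj C; f \<in> Hom C x y\<rbrakk> \<Longrightarrow> Comp C x y y (Id C y) f = f"
    and Comp_assoc: "\<lbrakk>w \<in> Obj C; x \<in> Obj C; y \<in> Obj C; z \<in> Obj C;
      f \<in> Hom C w x; g \<in> Hom C x y; h \<in> Hom C y z\<rbrakk>
      \<Longrightarrow> Comp C w y z h (Comp C w x y g f) = Comp C w x z (Comp C x y z h g) f"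

record ('o, 'm, 'p, 'n) fctr =
  FObj :: "'o \<Rightarrow> 'p"
  FMor :: "'o \<Rightarrow> 'o \<Rightarrow> 'm \<Rightarrow> 'n"

locale cat_functor = source: category C + target: category D
  for C :: "('o, 'm) cat" and D :: "('p, 'n) cat" +
  fixes F :: "('o, 'm, 'p, 'n) fctr"
  assumes FObj_in_Obj: "x \<in> Obj C \<Longrightarrow> FObj F x \<in> Obj D"
    and FMor_in_Hom: "\<lbrakk>x \<in> Obj C; y \<in> Obj C; f \<in> Hom C x y\<rbrakk>
      \<Longrightarrow> FMor F x y f \<in> Hom D (FObj F x) (FObj F y)"
    and FMor_Id: "x \<in> Obj C \<Longrightarrow> FMor F x x (Id C x) = Id D (FObj F x)"
    and FMor_Comp: "\<lbrakk>x \<in> Obj C; y \<in> Obj C; z \<in> Obj C; f \<in> Hom C x y; g \<in> Hom C y z\<rbrakk>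
      \<Longrightarrow> FMor F x z (Comp C x y z g f)
        = Comp D (FObj F x) (FObj F y) (FObj F z) (FMor F y z g) (FMor F x y f)"


section \<open>The dimension-shift category\<close>

definition Dim_plus :: "(real, real) cat" where
  "Dim_plus = \<lparr>Obj = {0<..}, Hom = (\<lambda>x y. {r. 0 \<le> r \<and> y = x + 2 * r}),
    Id = (\<lambda>x. 0), Comp = (\<lambda>x y z s r. r + s)\<rparr>"

lemma category_Dim_plus: "category Dim_plus"
  by unfold_locales (auto simp: Dim_plus_def)


section \<open>Radon measures on the open half-line\<close>

text \<open>
  Radon means inner regular with respect to compact sets. For locally finite Borel measures on
  \<open>(0, \<infinity>)\<close> this is automatic, and so the choice among the usual definitions is immaterial.
\<close>

definition radon_measure :: "real measure \<Rightarrow> bool" where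
  "radon_measure \<mu> \<longleftrightarrow>
    sets \<mu> = sets (restrict_space borel {0<..}) \<and>
    (\<forall>u>0. \<exists>U. open U \<and> u \<in> U \<and> U \<subseteq> {0<..} \<and> emeasure \<mu> U < \<infinity>) \<and>
    (\<forall>B\<in>sets \<mu>. emeasure \<mu> B = (SUP K\<in>{K. compact K \<and> K \<subseteq> B}. emeasure \<mu> K))"

text \<open>
  Functions on \<open>(0, \<infinity>)\<close> are functions on the reals whose values off \<open>(0, \<infinity>)\<close> do not matter:
  every measure considered has \<open>space \<mu> = {0<..}\<close>.
\<close>

definition pre_density :: "real measure \<Rightarrow> (real \<Rightarrow> real) \<Rightarrow> bool" where
  "pre_density \<mu> h \<longleftrightarrow> h \<in> borel_measurable \<mu> \<and> (\<forall>u>0. 0 \<le> h u)"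

definition density_from_to :: "real measure \<Rightarrow> real measure \<Rightarrow> (real \<Rightarrow> real) \<Rightarrow> bool" where
  "density_from_to \<mu> \<nu> h \<longleftrightarrow>
    pre_density \<mu> h \<and> (\<forall>B\<in>sets \<mu>. emeasure \<nu> B = (\<integral>\<^sup>+u\<in>B. ennreal (h u) \<partial>\<mu>))"

definition ae_class :: "real measure \<Rightarrow> (real \<Rightarrow> real) \<Rightarrow> (real \<Rightarrow> real) set" where
  "ae_class \<mu> h = {h'. pre_density \<mu> h' \<and> (AE u in \<mu>. h' u = h u)}"

definition RadMeas :: "(real measure, (real \<Rightarrow> real) set) cat" where
  "RadMeas = \<lparr>Obj = {\<mu>. radon_measure \<mu> \<and> emeasure \<mu> (space \<mu>) \<noteq> 0},
    Hom = (\<lambda>\<mu> \<nu>. {ae_class \<mu> h | h. density_from_to \<mu> \<nu> h}),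
    Id = (\<lambda>\<mu>. ae_class \<mu> (\<lambda>u. 1)),
    Comp = (\<lambda>\<mu> \<nu> \<rho> K H. {l. pre_density \<mu> l \<and> (\<exists>h\<in>H. \<exists>k\<in>K. AE u in \<mu>. l u = k u * h u)})\<rparr>"

lemma radon_measure_space:
  assumes "radon_measure \<mu>" shows "space \<mu> = {0<..}"
proof -
  have "sets \<mu> = sets (restrict_space borel {0<..})"
    using assms by (simp add: radon_measure_def)
  from sets_eq_imp_space_eq[OF this] show ?thesis
    by (simp add: space_restrict_space)
qed

lemma density_from_to_eq:
  assumes "radon_measure \<mu>" "radon_measure \<nu>" "density_from_to \<mu> \<nu> h"
  shows "\<nu> = density \<mu> (\<lambda>u. ennreal (h u))"
proof (rule measure_eqI)
  show s: "sets \<nu> = sets (density \<mu> (\<lambda>u. ennreal (h u)))"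
    using assms by (simp add: radon_measure_def)
  fix B assume "B \<in> sets \<nu>"
  then have "B \<in> sets \<mu>" using s by simp
  moreover have "h \<in> borel_measurable \<mu>"
    using assms(3) by (simp add: density_from_to_def pre_density_def)
  ultimately show "emeasure \<nu> B = emeasure (density \<mu> (\<lambda>u. ennreal (h u))) B"
    using assms(3) by (simp add: density_from_to_def emeasure_density)
qed

lemma density_from_toI:
  assumes "pre_density \<mu> h" "\<nu> = density \<mu> (\<lambda>u. ennreal (h u))"
  shows "density_from_to \<mu> \<nu> h"
  using assms by (auto simp: density_from_to_def pre_density_def emeasure_density)

lemma ae_class_self: "pre_density \<mu> h \<Longrightarrow> h \<in> ae_class \<mu> h"
  by (simp add: ae_class_def)

lemma Comp_ae_class:
  assumes \<mu>: "radon_measure \<mu>" and \<nu>: "radon_measure \<nu>"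
    and h: "density_from_to \<mu> \<nu> h" and k: "pre_density \<nu> k"
  shows "Comp RadMeas \<mu> \<nu> \<rho> (ae_class \<nu> k) (ae_class \<mu> h) = ae_class \<mu> (\<lambda>u. k u * h u)"
proof (intro equalityI subsetI)
  fix l assume "l \<in> ae_class \<mu> (\<lambda>u. k u * h u)"
  moreover have "h \<in> ae_class \<mu> h" "k \<in> ae_class \<nu> k"
    using h k by (auto intro: ae_class_self simp: density_from_to_def)
  ultimately show "l \<in> Comp RadMeas \<mu> \<nu> \<rho> (ae_class \<nu> k) (ae_class \<mu> h)"
    by (auto simp: RadMeas_def ae_class_def)
next
  fix l assume "l \<in> Comp RadMeas \<mu> \<nu> \<rho> (ae_class \<nu> k) (ae_class \<mu> h)"
  then obtain h' k' where l: "pre_density \<mu> l" "AE u in \<mu>. l u = k' u * h' u"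
    and h': "AE u in \<mu>. h' u = h u" and k': "AE u in \<nu>. k' u = k u"
    by (auto simp: RadMeas_def ae_class_def)
  have "AE u in density \<mu> (\<lambda>u. ennreal (h u)). k' u = k u"
    using k' by (simp only: density_from_to_eq[OF \<mu> \<nu> h, symmetric])
  moreover have "h \<in> borel_measurable \<mu>"
    using h by (simp add: density_from_to_def pre_density_def)
  ultimately have "AE u in \<mu>. 0 < ennreal (h u) \<longrightarrow> k' u = k u"
    by (simp add: AE_density)
  moreover have "AE u in \<mu>. 0 \<le> h u"
    using h radon_measure_space[OF \<mu>]
    by (intro AE_I2) (simp add: density_from_to_def pre_density_def)
  ultimately have "AE u in \<mu>. l u = k u * h u"
    using l(2) h' by eventually_elim (auto simp: ennreal_less_zero_iff order_le_less)
  then show "l \<in> ae_class \<mu> (\<lambda>u. k u * h u)"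
    using l(1) by (simp add: ae_class_def)
qed

lemma density_from_to_comp:
  assumes \<mu>: "radon_measure \<mu>" and \<nu>: "radon_measure \<nu>" and \<rho>: "radon_measure \<rho>"
    and h: "density_from_to \<mu> \<nu> h" and k: "density_from_to \<nu> \<rho> k"
  shows "density_from_to \<mu> \<rho> (\<lambda>u. k u * h u)"
proof (rule density_from_toI)
  have meas: "borel_measurable \<nu> = (borel_measurable \<mu> :: (real \<Rightarrow> real) set)"
    using \<mu> \<nu> by (intro measurable_cong_sets) (auto simp: radon_measure_def)
  have hm: "h \<in> borel_measurable \<mu>" and km: "k \<in> borel_measurable \<mu>"
    using h k meas by (auto simp: density_from_to_def pre_density_def)
  have h0: "0 \<le> h u" and k0: "0 \<le> k u" if "0 < u" for u
    using h k that by (auto simp: density_from_to_def pre_density_def)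
  show "pre_density \<mu> (\<lambda>u. k u * h u)"
    using hm km h0 k0 by (simp add: pre_density_def)
  have "\<rho> = density (density \<mu> (\<lambda>u. ennreal (h u))) (\<lambda>u. ennreal (k u))"
    using density_from_to_eq[OF \<mu> \<nu> h] density_from_to_eq[OF \<nu> \<rho> k] by simp
  also have "\<dots> = density \<mu> (\<lambda>u. ennreal (h u) * ennreal (k u))"
    using hm km by (intro density_density_eq) auto
  also have "\<dots> = density \<mu> (\<lambda>u. ennreal (k u * h u))"
    using hm km h0 k0 radon_measure_space[OF \<mu>]
    by (intro density_cong AE_I2) (auto simp: ennreal_mult' mult.commute)
  finally show "\<rho> = density \<mu> (\<lambda>u. ennreal (k u * h u))" .
qed

lemma category_RadMeas: "category RadMeas"
proof -
  have HomI: "ae_class \<mu> h \<in> Hom RadMeas \<mu> \<nu>" if "density_from_to \<mu> \<nu> h" for \<mu> \<nu> h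
    using that by (auto simp: RadMeas_def)
  have HomE: "\<exists>h. H = ae_class \<mu> h \<and> density_from_to \<mu> \<nu> h" if "H \<in> Hom RadMeas \<mu> \<nu>" for \<mu> \<nu> H
    using that by (auto simp: RadMeas_def)
  have rad: "radon_measure \<mu>" if "\<mu> \<in> Obj RadMeas" for \<mu>
    using that by (simp add: RadMeas_def)
  have one: "density_from_to \<mu> \<mu> (\<lambda>u. 1)" for \<mu>
    by (simp add: density_from_to_def pre_density_def)
  have pre: "pre_density \<mu> h" if "density_from_to \<mu> \<nu> h" for \<mu> \<nu> h
    using that by (simp add: density_from_to_def)
  have Id: "Id RadMeas \<mu> = ae_class \<mu> (\<lambda>u. 1)" for \<mu>
    by (simp add: RadMeas_def)
  show ?thesis
  proof
    fix \<mu> assume "\<mu> \<in> Obj RadMeas"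
    show "Id RadMeas \<mu> \<in> Hom RadMeas \<mu> \<mu>"
      unfolding Id by (intro HomI one)
  next
    fix \<mu> \<nu> \<rho> H K
    assume o: "\<mu> \<in> Obj RadMeas" "\<nu> \<in> Obj RadMeas" "\<rho> \<in> Obj RadMeas"
      and H: "H \<in> Hom RadMeas \<mu> \<nu>" and K: "K \<in> Hom RadMeas \<nu> \<rho>"
    from HomE[OF H] HomE[OF K] obtain h k
      where h: "H = ae_class \<mu> h" "density_from_to \<mu> \<nu> h"
        and k: "K = ae_class \<nu> k" "density_from_to \<nu> \<rho> k" by blast
    show "Comp RadMeas \<mu> \<nu> \<rho> K H \<in> Hom RadMeas \<mu> \<rho>"
      unfolding h(1) k(1) Comp_ae_class[OF rad[OF o(1)] rad[OF o(2)] h(2) pre[OF k(2)]]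
      by (intro HomI density_from_to_comp[OF rad[OF o(1)] rad[OF o(2)] rad[OF o(3)] h(2) k(2)])
  next
    fix \<mu> \<nu> H
    assume o: "\<mu> \<in> Obj RadMeas" "\<nu> \<in> Obj RadMeas" and H: "H \<in> Hom RadMeas \<mu> \<nu>"
    from HomE[OF H] obtain h where h: "H = ae_class \<mu> h" "density_from_to \<mu> \<nu> h" by blast
    show "Comp RadMeas \<mu> \<mu> \<nu> H (Id RadMeas \<mu>) = H"
      unfolding h(1) Id Comp_ae_class[OF rad[OF o(1)] rad[OF o(1)] one pre[OF h(2)]] by simp
    show "Comp RadMeas \<mu> \<nu> \<nu> (Id RadMeas \<nu>) H = H"
      unfolding h(1) Id Comp_ae_class[OF rad[OF o(1)] rad[OF o(2)] h(2) pre[OF one]] by simp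
  next
    fix \<mu> \<nu> \<rho> \<sigma> H K L
    assume o: "\<mu> \<in> Obj RadMeas" "\<nu> \<in> Obj RadMeas" "\<rho> \<in> Obj RadMeas" "\<sigma> \<in> Obj RadMeas"
      and H: "H \<in> Hom RadMeas \<mu> \<nu>" and K: "K \<in> Hom RadMeas \<nu> \<rho>" and L: "L \<in> Hom RadMeas \<rho> \<sigma>"
    from HomE[OF H] HomE[OF K] HomE[OF L] obtain h k l
      where h: "H = ae_class \<mu> h" "density_from_to \<mu> \<nu> h"
        and k: "K = ae_class \<nu> k" "density_from_to \<nu> \<rho> k"
        and l: "L = ae_class \<rho> l" "density_from_to \<rho> \<sigma> l" by blast
    note r = o[THEN rad]
    have kh: "density_from_to \<mu> \<rho> (\<lambda>u. k u * h u)"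
      by (rule density_from_to_comp[OF r(1) r(2) r(3) h(2) k(2)])
    have lk: "density_from_to \<nu> \<sigma> (\<lambda>u. l u * k u)"
      by (rule density_from_to_comp[OF r(2) r(3) r(4) k(2) l(2)])
    show "Comp RadMeas \<mu> \<rho> \<sigma> L (Comp RadMeas \<mu> \<nu> \<rho> K H)
        = Comp RadMeas \<mu> \<nu> \<sigma> (Comp RadMeas \<nu> \<rho> \<sigma> L K) H"
      unfolding h(1) k(1) l(1) Comp_ae_class[OF r(1) r(2) h(2) pre[OF k(2)]]
        Comp_ae_class[OF r(2) r(3) k(2) pre[OF l(2)]]
        Comp_ae_class[OF r(1) r(3) kh pre[OF l(2)]]
        Comp_ae_class[OF r(1) r(2) h(2) pre[OF lk]]
      by (simp add: mult.assoc)
  qed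
qed


section \<open>Scaling-covariant homogeneous functors\<close>

type_synonym dim_functor = "(real, real, real measure, (real \<Rightarrow> real) set) fctr"

definition Cc_half_line :: "(real \<Rightarrow> real) set" where
  "Cc_half_line = {\<phi>. continuous_on {0<..} \<phi> \<and>
    (\<exists>K. compact K \<and> K \<subseteq> {0<..} \<and> (\<forall>u>0. u \<notin> K \<longrightarrow> \<phi> u = 0))}"

definition scaling_covariant :: "dim_functor \<Rightarrow> bool" where
  "scaling_covariant F \<longleftrightarrow> (\<forall>x>0. \<forall>\<phi>\<in>Cc_half_line. \<forall>t>0.
    (\<integral>u. \<phi> (t * u) \<partial>FObj F x) = t powr (- x / 2) * (\<integral>u. \<phi> u \<partial>FObj F x))"

definition homogeneous_with :: "dim_functor \<Rightarrow> (real \<Rightarrow> real \<Rightarrow> real) \<Rightarrow> bool" where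
  "homogeneous_with F A \<longleftrightarrow> (\<forall>x>0. \<forall>r\<ge>0. 0 < A x r \<and>
    FMor F x (x + 2 * r) r = ae_class (FObj F x) (\<lambda>u. A x r * u powr r))"

definition scaling_covariant_homogeneous :: "dim_functor \<Rightarrow> bool" where
  "scaling_covariant_homogeneous F \<longleftrightarrow>
    cat_functor Dim_plus RadMeas F \<and> scaling_covariant F \<and> (\<exists>A. homogeneous_with F A)"

definition power_measure :: "real \<Rightarrow> real \<Rightarrow> real measure" where
  "power_measure a p = density (restrict_space lborel {0<..}) (\<lambda>u. ennreal (a * u powr p))"

definition power_functor :: "(real \<Rightarrow> real) \<Rightarrow> (real \<Rightarrow> real \<Rightarrow> real) \<Rightarrow> dim_functor" where
  "power_functor c A = \<lparr>FObj = (\<lambda>x. power_measure (c x) (x / 2 - 1)),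
    FMor = (\<lambda>x y r. ae_class (power_measure (c x) (x / 2 - 1)) (\<lambda>u. A x r * u powr r))\<rparr>"

end

theory Submission
  imports Defs
begin

text \<open>
  Exhausting intervals by functions in \<open>C\<^sub>c\<close> turns scaling covariance into
  \<open>\<mu>(a/t, b/t) = t\<^sup>-\<^sup>p \<mu>(a, b)\<close> with \<open>p = x/2\<close>. Since \<open>p > 0\<close>, the mass \<open>m = \<mu>(0, 1)\<close> is finite, and then
  \<open>\<mu>(0, b) = m b\<^sup>p\<close> determines \<open>\<mu>\<close>, with \<open>c(x) = p m\<close>. The morphism \<open>F(r)\<close> multiplies the density
  \<open>c(x) u\<^sup>p\<^sup>-\<^sup>1\<close> by \<open>A(x, r) u\<^sup>r\<close>, and comparing the result with \<open>F(x + 2r)\<close> gives \<open>A\<close>.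
\<close>

section \<open>Power measures\<close>

lemma sets_restrict_space_lborel [simp]:
  "sets (restrict_space lborel \<Omega>) = sets (restrict_space borel \<Omega>)"
  by (rule sets_restrict_space_cong) simp

lemma sets_power_measure [simp]:
  "sets (power_measure a p) = sets (restrict_space borel {0<..})"
  by (simp add: power_measure_def)

lemma space_power_measure [simp]: "space (power_measure a p) = {0<..}"
  by (simp add: power_measure_def space_restrict_space)

lemma borel_measurable_power_measure:
  "borel_measurable (power_measure a p) = borel_measurable (restrict_space borel {0<..})"
  by (rule measurable_cong_sets) auto

lemma sets_restrict_space_borel_half_line:
  "B \<in> sets (restrict_space borel {0::real<..}) \<longleftrightarrow> B \<in> sets borel \<and> B \<subseteq> {0<..}"
  by (auto simp: sets_restrict_space_iff)

lemma nn_integral_power_measure: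
  assumes "f \<in> borel_measurable (restrict_space borel {0<..})"
  shows "(\<integral>\<^sup>+u. f u \<partial>power_measure a p)
    = (\<integral>\<^sup>+u. ennreal (a * u powr p) * f u * indicator {0<..} u \<partial>lborel)"
proof -
  have 1: "(\<lambda>u::real. ennreal (a * u powr p)) \<in> borel_measurable (restrict_space lborel {0<..})"
    by (intro measurable_restrict_space1) simp
  have 2: "f \<in> borel_measurable (restrict_space lborel {0<..})"
    using assms by (simp add: measurable_cong_sets[OF sets_restrict_space_lborel refl])
  show ?thesis
    unfolding power_measure_def
    by (simp add: nn_integral_density[OF 1 2] nn_integral_restrict_space)
qed

text \<open>The sign of \<open>a\<close> matters here, because \<open>ennreal\<close> truncates a
  negative density to 0, while the real factor \<open>a * u powr p\<close> on the right would keep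
  its sign.\<close>

lemma integral_power_measure:
  fixes f :: "real \<Rightarrow> real"
  assumes "f \<in> borel_measurable (restrict_space borel {0<..})" and "0 \<le> a"
  shows "(\<integral>u. f u \<partial>power_measure a p)
    = (\<integral>u. indicator {0<..} u * (a * u powr p * f u) \<partial>lborel)"
proof -
  have 1: "(\<lambda>u::real. a * u powr p) \<in> borel_measurable (restrict_space lborel {0<..})"
    by (intro measurable_restrict_space1) simp
  have 2: "f \<in> borel_measurable (restrict_space lborel {0<..})"
    using assms by (simp add: measurable_cong_sets[OF sets_restrict_space_lborel refl])
  show ?thesis
    unfolding power_measure_def
    using 1 2 \<open>0 \<le> a\<close> by (simp add: integral_density integral_restrict_space)
qed

lemma emeasure_power_measure:
  assumes "B \<in> sets borel" "B \<subseteq> {0<..}"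
  shows "emeasure (power_measure a p) B = (\<integral>\<^sup>+u\<in>B. ennreal (a * u powr p) \<partial>lborel)"
proof -
  have B: "B \<in> sets (power_measure a p)"
    using assms by (simp add: sets_restrict_space_borel_half_line)
  then have "emeasure (power_measure a p) B = (\<integral>\<^sup>+u. indicator B u \<partial>power_measure a p)"
    by simp
  also have "\<dots> = (\<integral>\<^sup>+u. ennreal (a * u powr p) * indicator B u * indicator {0<..} u \<partial>lborel)"
    using B by (intro nn_integral_power_measure) simp
  also have "\<dots> = (\<integral>\<^sup>+u\<in>B. ennreal (a * u powr p) \<partial>lborel)"
    using assms(2) by (intro nn_integral_cong) (auto simp: indicator_def)
  finally show ?thesis .
qed

text \<open>The antiderivative \<open>u powr p / p\<close> vanishes at 0, and \<open>0 < p\<close>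
  makes the singularity of the integrand at 0 integrable.\<close>

lemma emeasure_power_measure_Ioo:
  assumes "0 < p" "0 \<le> c" "0 < b"
  shows "emeasure (power_measure c (p - 1)) {0<..<b} = ennreal (c / p * b powr p)"
proof -
  have "((\<lambda>u. u powr (p - 1)) has_integral b powr p / p) {0..b}"
    using has_integral_powr_from_0[of "p - 1" b] assms by simp
  then have "((\<lambda>u. c * u powr (p - 1)) has_integral c * (b powr p / p)) {0..b}"
    by (rule has_integral_mult_right)
  then have "((\<lambda>u. c * u powr (p - 1)) has_integral c * (b powr p / p)) {0<..<b}"
    by (simp add: has_integral_Icc_iff_Ioo)
  then have "((\<lambda>u. if u \<in> {0<..<b} then c * u powr (p - 1) else 0)
      has_integral c * (b powr p / p)) UNIV"
    by (simp only: has_integral_restrict_UNIV)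
  then have "(\<integral>\<^sup>+u. ennreal (if u \<in> {0<..<b} then c * u powr (p - 1) else 0) \<partial>lborel)
      = ennreal (c * (b powr p / p))"
    using assms by (intro nn_integral_has_integral_lborel) auto
  moreover have "(\<integral>\<^sup>+u\<in>{0<..<b}. ennreal (c * u powr (p - 1)) \<partial>lborel)
      = (\<integral>\<^sup>+u. ennreal (if u \<in> {0<..<b} then c * u powr (p - 1) else 0) \<partial>lborel)"
    by (intro nn_integral_cong) (auto simp: indicator_def)
  ultimately show ?thesis
    by (subst emeasure_power_measure) auto
qed

text \<open>Both directions of the classification rest on this computation: a homogeneous density
  adds to the exponent and multiplies the coefficient.\<close>

lemma density_power_measure:
  assumes "0 \<le> c" "0 \<le> k"
  shows "density (power_measure c p) (\<lambda>u. ennreal (k * u powr r)) = power_measure (k * c) (p + r)"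
proof -
  have m: "(\<lambda>u::real. ennreal (k * u powr r)) \<in> borel_measurable (restrict_space lborel {0<..})"
    for k r by (intro measurable_restrict_space1) simp
  have "density (power_measure c p) (\<lambda>u. ennreal (k * u powr r))
      = density (restrict_space lborel {0<..}) (\<lambda>u. ennreal (c * u powr p) * ennreal (k * u powr r))"
    unfolding power_measure_def by (rule density_density_eq[OF m m])
  also have "\<dots> = power_measure (k * c) (p + r)"
    unfolding power_measure_def using assms
    by (intro density_cong[OF borel_measurable_times_ennreal[OF m m] m])
      (simp add: powr_add ennreal_mult[symmetric] mult_ac)
  finally show ?thesis .
qed

section \<open>Power measures as objects of \<open>RadMeas\<close>\<close>

lemma emeasure_power_measure_finite:
  assumes "0 < p" "0 \<le> c" "B \<in> sets borel" "B \<subseteq> {0<..<b}"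
  shows "emeasure (power_measure c (p - 1)) B < \<infinity>"
proof (cases "0 < b")
  case True
  have "emeasure (power_measure c (p - 1)) B \<le> emeasure (power_measure c (p - 1)) {0<..<b}"
    using assms by (intro emeasure_mono) (auto simp: sets_restrict_space_borel_half_line)
  also have "\<dots> < \<infinity>"
    using assms True by (simp add: emeasure_power_measure_Ioo)
  finally show ?thesis .
next
  case False
  then have "B = {}"
    using assms(4) by auto
  then show ?thesis by simp
qed

text \<open>A set reaching to infinity may have infinite mass, so it is exhausted by its bounded
  pieces. No cut near 0 has to be made, since \<open>0 < p\<close> already gives every bounded piece
  finite mass.\<close>

lemma power_measure_inner_regular:
  assumes p: "0 < p" and c: "0 \<le> c" and B: "B \<in> sets borel" "B \<subseteq> {0<..}"
  shows "emeasure (power_measure c (p - 1)) B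
    = (SUP K\<in>{K. compact K \<and> K \<subseteq> B}. emeasure (power_measure c (p - 1)) K)"
    (is "emeasure ?M B = ?S")
proof (rule antisym)
  define B' where "B' n = B \<inter> {0<..<real n}" for n
  have B': "B' n \<in> sets ?M" "B' n \<in> sets borel" "B' n \<subseteq> {0<..<real n}" for n
    using B by (auto simp: B'_def sets_restrict_space_borel_half_line)
  have "B = (\<Union>n. B' n)"
  proof -
    have "\<exists>n. u < real n" for u :: real
      by (rule reals_Archimedean2)
    then show ?thesis
      using B(2) by (auto simp: B'_def)
  qed
  moreover have "incseq B'"
    by (auto simp: B'_def incseq_def)
  ultimately have "emeasure ?M B = (SUP n. emeasure ?M (B' n))"
    using SUP_emeasure_incseq[of B' ?M] B'(1) by (simp add: image_subset_iff)
  also have "\<dots> \<le> ?S"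
  proof (rule SUP_least)
    fix n
    txt \<open>Regularity is available for finite Borel measures on the whole line.\<close>
    define N where "N = density lborel (\<lambda>u. ennreal (c * u powr (p - 1)) * indicator {0<..<real n} u)"
    have N: "emeasure N A = emeasure ?M (A \<inter> {0<..<real n})" if "A \<in> sets borel" for A
    proof -
      have "emeasure N A
          = (\<integral>\<^sup>+u. ennreal (c * u powr (p - 1)) * indicator {0<..<real n} u * indicator A u \<partial>lborel)"
        unfolding N_def using that by (intro emeasure_density) auto
      also have "\<dots> = (\<integral>\<^sup>+u\<in>A \<inter> {0<..<real n}. ennreal (c * u powr (p - 1)) \<partial>lborel)"
        by (intro nn_integral_cong) (auto simp: indicator_def)
      also have "\<dots> = emeasure ?M (A \<inter> {0<..<real n})"
        using that by (intro emeasure_power_measure[symmetric]) auto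
      finally show ?thesis .
    qed
    have sN: "sets N = sets borel"
      by (simp add: N_def)
    have "emeasure N (space N) \<noteq> \<infinity>"
      using emeasure_power_measure_finite[OF p c, of "{0<..<real n}" "real n"]
      by (subst N) (auto simp: N_def)
    then have "emeasure N (B' n) = (SUP K\<in>{K. K \<subseteq> B' n \<and> compact K}. emeasure N K)"
      by (intro inner_regular sN B')
    also have "\<dots> \<le> ?S"
    proof (rule SUP_least)
      fix K assume K: "K \<in> {K. K \<subseteq> B' n \<and> compact K}"
      then have "K \<inter> {0<..<real n} = K" "K \<subseteq> B" "compact K" "K \<in> sets borel"
        by (auto simp: B'_def intro: borel_compact)
      then show "emeasure N K \<le> ?S"
        by (auto simp: N intro!: SUP_upper)
    qed
    finally show "emeasure ?M (B' n) \<le> ?S"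
      using B'(2,3)[of n] by (simp add: N Int_absorb2)
  qed
  finally show "emeasure ?M B \<le> ?S" .
  show "?S \<le> emeasure ?M B"
    using B by (intro SUP_least emeasure_mono) (auto simp: sets_restrict_space_borel_half_line)
qed

lemma radon_measure_power_measure:
  assumes "0 < p" "0 \<le> c"
  shows "radon_measure (power_measure c (p - 1))"
  unfolding radon_measure_def
proof (intro conjI allI impI ballI)
  fix u :: real assume "0 < u"
  with assms emeasure_power_measure_finite[of p c "{0<..<u + 1}" "u + 1"]
  show "\<exists>U. open U \<and> u \<in> U \<and> U \<subseteq> {0<..} \<and> emeasure (power_measure c (p - 1)) U < \<infinity>"
    by (intro exI[of _ "{0<..<u + 1}"]) auto
qed (use assms in \<open>auto intro!: power_measure_inner_regular simp: sets_restrict_space_borel_half_line\<close>)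

text \<open>The measure is nonzero because the unit interval (0, 1) already has mass
  \<open>c / p\<close>.\<close>

lemma power_measure_in_Obj_RadMeas:
  assumes "0 < p" "0 < c"
  shows "power_measure c (p - 1) \<in> Obj RadMeas"
proof -
  have "0 < emeasure (power_measure c (p - 1)) {0<..<1}"
    using assms by (simp add: emeasure_power_measure_Ioo)
  also have "\<dots> \<le> emeasure (power_measure c (p - 1)) (space (power_measure c (p - 1)))"
    by (rule emeasure_space)
  finally show ?thesis
    using assms by (auto simp: RadMeas_def radon_measure_power_measure)
qed

text \<open>Under the substitution v = t u the weight contributes \<open>t powr (1 - p)\<close> and
  Lebesgue measure contributes \<open>1 / t\<close>, which together give
  \<open>t powr (- p)\<close>.\<close>

lemma integral_power_measure_scale:
  fixes f :: "real \<Rightarrow> real"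
  assumes f: "f \<in> borel_measurable (restrict_space borel {0<..})"
    and ft: "(\<lambda>u. f (t * u)) \<in> borel_measurable (restrict_space borel {0<..})"
    and "0 \<le> c" "0 < t"
  shows "(\<integral>u. f (t * u) \<partial>power_measure c (p - 1)) = t powr (- p) * (\<integral>u. f u \<partial>power_measure c (p - 1))"
proof -
  define g where "g u = indicator {0<..} u * (c * u powr (p - 1) * f u)" for u :: real
  \<comment> \<open>The summand 0 puts the argument into the affine form of
    \<open>lborel_integral_real_affine\<close>.\<close>
  have "(\<integral>u. f (t * u) \<partial>power_measure c (p - 1)) = (\<integral>u. t powr (1 - p) * g (0 + t * u) \<partial>lborel)"
    unfolding integral_power_measure[OF ft \<open>0 \<le> c\<close>]
  proof (rule Bochner_Integration.integral_cong[OF refl])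
    fix u :: real
    have "t powr (1 - p) * (t powr (p - 1)) = 1"
      using \<open>0 < t\<close> by (simp flip: powr_add)
    then show "indicator {0<..} u * (c * u powr (p - 1) * f (t * u)) = t powr (1 - p) * g (0 + t * u)"
      using \<open>0 < t\<close> by (auto simp: g_def indicator_def powr_mult zero_less_mult_iff)
  qed
  also have "\<dots> = t powr (- p) * (t * (\<integral>u. g (0 + t * u) \<partial>lborel))"
    using \<open>0 < t\<close> by (simp add: powr_diff powr_minus_divide)
  also have "t * (\<integral>u. g (0 + t * u) \<partial>lborel) = (\<integral>u. g u \<partial>lborel)"
    using \<open>0 < t\<close> by (subst lborel_integral_real_affine[of t g 0]) auto
  also have "(\<integral>u. g u \<partial>lborel) = (\<integral>u. f u \<partial>power_measure c (p - 1))"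
    unfolding g_def integral_power_measure[OF f \<open>0 \<le> c\<close>] ..
  finally show ?thesis .
qed


section \<open>Uniqueness of homogeneous Radon measures\<close>

lemma Cc_half_line_measurable:
  "\<phi> \<in> Cc_half_line \<Longrightarrow> \<phi> \<in> borel_measurable (restrict_space borel {0<..})"
  by (simp add: Cc_half_line_def borel_measurable_continuous_on_restrict)

text \<open>If the function vanishes off \<open>K\<close>, its dilate vanishes off \<open>K\<close>
  divided by \<open>t\<close>, again a compact subset of the half-line.\<close>

lemma Cc_half_line_scale:
  assumes "\<phi> \<in> Cc_half_line" "0 < t"
  shows "(\<lambda>u. \<phi> (t * u)) \<in> Cc_half_line"
proof -
  from assms obtain K where K: "compact K" "K \<subseteq> {0<..}" "\<And>u. 0 < u \<Longrightarrow> u \<notin> K \<Longrightarrow> \<phi> u = 0"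
    and cont: "continuous_on {0<..} \<phi>"
    by (auto simp: Cc_half_line_def)
  have "continuous_on {0<..} (\<lambda>u. \<phi> (t * u))"
    using \<open>0 < t\<close> by (intro continuous_on_compose2[OF cont] continuous_intros) auto
  moreover have "compact ((\<lambda>u. u / t) ` K)" "(\<lambda>u. u / t) ` K \<subseteq> {0<..}"
    using K(1,2) \<open>0 < t\<close> by (auto intro!: compact_continuous_image continuous_intros)
  moreover have "\<phi> (t * u) = 0" if "0 < u" "u \<notin> (\<lambda>u. u / t) ` K" for u
  proof (rule K(3))
    show "t * u \<notin> K"
      using that \<open>0 < t\<close> by (force simp: image_iff)
  qed (use that \<open>0 < t\<close> in auto)
  ultimately show ?thesis
    unfolding Cc_half_line_def by blast
qed

text \<open>Local finiteness covers \<open>K\<close> by open sets of finite mass, and finitely many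
  of them suffice.\<close>

lemma radon_measure_compact_finite:
  assumes \<mu>: "radon_measure \<mu>" and K: "compact K" "K \<subseteq> {0<..}"
  shows "emeasure \<mu> K < \<infinity>"
proof -
  define \<U> where "\<U> = {U. open U \<and> U \<subseteq> {0<..} \<and> emeasure \<mu> U < \<infinity>}"
  have sets: "U \<in> sets \<mu>" if "U \<in> \<U>" for U
    using that \<mu> by (auto simp: \<U>_def radon_measure_def sets_restrict_space_borel_half_line)
  have "K \<subseteq> \<Union>\<U>"
    using \<mu> K(2) unfolding radon_measure_def \<U>_def by blast
  with K(1) obtain \<D> where \<D>: "\<D> \<subseteq> \<U>" "finite \<D>" "K \<subseteq> \<Union>\<D>"
    by (rule compactE) (auto simp: \<U>_def)
  have "emeasure \<mu> K \<le> emeasure \<mu> (\<Union>U\<in>\<D>. U)"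
    using \<D> sets by (intro emeasure_mono sets.finite_UN) auto
  also have "\<dots> \<le> (\<Sum>U\<in>\<D>. emeasure \<mu> U)"
    using \<D> sets by (intro emeasure_subadditive_finite) auto
  also have "\<dots> < \<infinity>"
    using \<D> by (auto simp: \<U>_def)
  finally show ?thesis .
qed

text \<open>Integrability allows the Bochner integrals of scaling covariance to be replaced by
  nonnegative integrals, to which monotone convergence applies. It holds because the function is
  bounded on a compact set of finite mass and vanishes elsewhere.\<close>

lemma integrable_Cc_half_line:
  assumes \<mu>: "radon_measure \<mu>" and \<phi>: "\<phi> \<in> Cc_half_line"
  shows "integrable \<mu> \<phi>"
proof -
  from \<phi> obtain K where K: "compact K" "K \<subseteq> {0<..}" "\<And>u. 0 < u \<Longrightarrow> u \<notin> K \<Longrightarrow> \<phi> u = 0"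
    and cont: "continuous_on {0<..} \<phi>"
    by (auto simp: Cc_half_line_def)
  have "compact (\<phi> ` K)"
    using K cont by (intro compact_continuous_image) (auto intro: continuous_on_subset)
  then obtain M where M: "\<And>u. u \<in> K \<Longrightarrow> norm (\<phi> u) \<le> M"
    by (meson bounded_iff compact_imp_bounded imageI)
  have s: "sets \<mu> = sets (restrict_space borel {0<..})"
    using \<mu> by (simp add: radon_measure_def)
  show ?thesis
  proof (rule integrableI_bounded_set)
    show "K \<in> sets \<mu>"
      using K by (auto simp: s sets_restrict_space_borel_half_line intro: borel_compact)
    show "\<phi> \<in> borel_measurable \<mu>"
      using Cc_half_line_measurable[OF \<phi>] by (simp add: measurable_cong_sets[OF s refl])
    show "emeasure \<mu> K < \<infinity>"
      using K by (intro radon_measure_compact_finite[OF \<mu>])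
    show "AE u in \<mu>. u \<in> K \<longrightarrow> norm (\<phi> u) \<le> M"
      using M by simp
    show "AE u in \<mu>. u \<notin> K \<longrightarrow> \<phi> u = 0"
      using K(3) radon_measure_space[OF \<mu>] by (intro AE_I2) auto
  qed
qed

section \<open>Approximation of open intervals from below\<close>

text \<open>A trapezoid that vanishes up to distance \<open>1 / Suc n\<close> from the endpoints and
  equals 1 from distance \<open>2 / Suc n\<close> on. Subtracting 1 creates the margin that keeps
  the support compact in the open half-line even when \<open>a = 0\<close>.\<close>

definition Ioo_bump :: "real \<Rightarrow> real \<Rightarrow> nat \<Rightarrow> real \<Rightarrow> real" where
  "Ioo_bump a b n u = max 0 (min 1 (real (Suc n) * min (u - a) (b - u) - 1))"

lemma Ioo_bump_nonneg: "0 \<le> Ioo_bump a b n u"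
  by (simp add: Ioo_bump_def)

lemma Ioo_bump_Cc:
  assumes "0 \<le> a"
  shows "Ioo_bump a b n \<in> Cc_half_line"
proof -
  define e where "e = 1 / real (Suc n)"
  have e: "0 < e" "real (Suc n) * e = 1"
    by (simp_all add: e_def)
  have "Ioo_bump a b n u = 0" if "u \<notin> {a + e..b - e}" for u
  proof -
    have "min (u - a) (b - u) \<le> e"
      using that by auto
    then have "real (Suc n) * min (u - a) (b - u) \<le> 1"
      using mult_left_mono[of _ e "real (Suc n)"] e(2) by fastforce
    then show ?thesis
      by (simp add: Ioo_bump_def)
  qed
  moreover have "continuous_on {0<..} (Ioo_bump a b n)"
    unfolding Ioo_bump_def by (intro continuous_intros)
  moreover have "{a + e..b - e} \<subseteq> {0<..}"
    using assms e by auto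
  ultimately show ?thesis
    unfolding Cc_half_line_def using compact_Icc by blast
qed

text \<open>Between the endpoints the scaled distance grows with \<open>n\<close>. Outside it is
  negative and decreases, but truncation at 0 makes all the bumps vanish there.\<close>

lemma incseq_Ioo_bump: "incseq (\<lambda>n. Ioo_bump a b n u)"
proof (cases "0 \<le> min (u - a) (b - u)")
  case True
  have "Ioo_bump a b m u \<le> Ioo_bump a b n u" if "m \<le> n" for m n
  proof -
    have "real (Suc m) * min (u - a) (b - u) \<le> real (Suc n) * min (u - a) (b - u)"
      using that True by (intro mult_right_mono) auto
    then show ?thesis
      unfolding Ioo_bump_def by linarith
  qed
  then show ?thesis
    by (simp add: incseq_def)
next
  case False
  then have "real (Suc n) * min (u - a) (b - u) \<le> 0" for n
    by (intro mult_nonneg_nonpos) auto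
  then have "Ioo_bump a b n u = 0" for n
    unfolding Ioo_bump_def by (smt (verit))
  then show ?thesis
    by (simp add: incseq_def)
qed

lemma Ioo_bump_LIMSEQ: "(\<lambda>n. Ioo_bump a b n u) \<longlonglongrightarrow> indicator {a<..<b} u"
proof (cases "u \<in> {a<..<b}")
  case True
  then have d: "0 < min (u - a) (b - u)" by auto
  \<comment> \<open>From this index on, the scaled distance exceeds 2, so the plateau value 1 is
    reached.\<close>
  obtain N where N: "2 / min (u - a) (b - u) < real N"
    using reals_Archimedean2 by blast
  have "Ioo_bump a b n u = 1" if "N \<le> n" for n
  proof -
    have "2 < real N * min (u - a) (b - u)"
      using N d by (simp only: pos_divide_less_eq)
    also have "\<dots> \<le> real (Suc n) * min (u - a) (b - u)"
      using that d by (intro mult_right_mono) auto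
    finally show ?thesis
      unfolding Ioo_bump_def by linarith
  qed
  then have "eventually (\<lambda>n. Ioo_bump a b n u = 1) sequentially"
    by (auto simp: eventually_sequentially)
  then show ?thesis
    using True by (simp add: tendsto_eventually)
next
  case False
  then have "min (u - a) (b - u) \<le> 0" by auto
  then have "real (Suc n) * min (u - a) (b - u) \<le> 0" for n
    by (intro mult_nonneg_nonpos) auto
  then have "Ioo_bump a b n u = 0" for n
    unfolding Ioo_bump_def by (smt (verit))
  then show ?thesis
    using False by simp
qed

text \<open>Monotone convergence carries statements about test functions over to intervals. The
  limit lives in \<open>ennreal\<close>, since for \<open>a = 0\<close> the mass is not yet known to
  be finite. Dilating the argument by \<open>t\<close> divides the endpoints by
  \<open>t\<close>.\<close>

lemma emeasure_Ioo_LIMSEQ: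
  assumes \<mu>: "radon_measure \<mu>" and "0 \<le> a" "0 < t"
  shows "(\<lambda>n. ennreal (\<integral>u. Ioo_bump a b n (t * u) \<partial>\<mu>)) \<longlonglongrightarrow> emeasure \<mu> {a / t<..<b / t}"
proof -
  let ?f = "\<lambda>n u. ennreal (Ioo_bump a b n (t * u))"
  have int: "integrable \<mu> (\<lambda>u. Ioo_bump a b n (t * u))" for n
    using assms by (intro integrable_Cc_half_line Cc_half_line_scale Ioo_bump_Cc)
  have "(\<lambda>n. \<integral>\<^sup>+u. ?f n u \<partial>\<mu>) \<longlonglongrightarrow> (\<integral>\<^sup>+u. indicator {a / t<..<b / t} u \<partial>\<mu>)"
  proof (rule nn_integral_LIMSEQ)
    show "incseq ?f"
      using incseq_Ioo_bump by (auto simp: incseq_def le_fun_def intro!: ennreal_leI)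
    show "?f n \<in> borel_measurable \<mu>" for n
      using int by (intro measurable_compose[OF _ measurable_ennreal]) (rule borel_measurable_integrable)
    fix u
    have "(indicator {a<..<b} (t * u) :: real) = indicator {a / t<..<b / t} u"
      using \<open>0 < t\<close> by (auto simp: indicator_def field_simps)
    then show "(\<lambda>n. ?f n u) \<longlonglongrightarrow> indicator {a / t<..<b / t} u"
      using tendsto_ennrealI[OF Ioo_bump_LIMSEQ[of a b "t * u"]] by (simp add: ennreal_indicator)
  qed
  moreover have "(\<integral>\<^sup>+u. ?f n u \<partial>\<mu>) = ennreal (\<integral>u. Ioo_bump a b n (t * u) \<partial>\<mu>)" for n
    using int by (intro nn_integral_eq_integral) (auto simp: Ioo_bump_nonneg)
  moreover have "{a / t<..<b / t} \<in> sets \<mu>"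
  proof -
    have "0 \<le> a / t"
      using assms by simp
    then have "{a / t<..<b / t} \<subseteq> {0<..}"
      by auto
    with \<mu> show ?thesis
      by (simp add: radon_measure_def sets_restrict_space_borel_half_line)
  qed
  ultimately show ?thesis
    by simp
qed

section \<open>Measures determined by their scaling\<close>

text \<open>These intervals are the traces of the rays that generate the Borel sets of the line.
  They are closed under intersection, so a measure can be identified from its masses on
  them.\<close>

lemma sets_half_line_generator:
  "sets (restrict_space borel {0::real<..}) = sigma_sets {0<..} (range (\<lambda>b. {0<..<b}))"
proof -
  have "sets (restrict_space borel {0::real<..}) = (\<inter>) {0<..} ` sigma_sets UNIV (range lessThan)"
    by (simp add: sets_restrict_space borel_Iio)
  also have "\<dots> = sigma_sets {0<..} ((\<inter>) {0<..} ` range lessThan)"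
  proof (rule sigma_sets_Int)
    have "{0::real<..} \<in> sets borel" by simp
    then show "{0::real<..} \<in> sigma_sets UNIV (range lessThan)"
      by (simp add: borel_Iio)
  qed simp
  also have "(\<inter>) {0::real<..} ` range lessThan = range (\<lambda>b. {0<..<b})"
    by (auto simp: image_image greaterThanLessThan_def)
  finally show ?thesis .
qed

text \<open>
  The scaling relation only controls dilations of an interval with a finite mass, so that the mass
  near \<open>0\<close> has to be bounded separately: \<open>(0, 1)\<close> is covered by the dilates of \<open>(1/4, 1)\<close> by
  powers of \<open>1/2\<close>, whose masses form a convergent geometric series because \<open>p > 0\<close>.
\<close>

lemma homogeneous_radon_measure_finite_near_0:
  assumes \<mu>: "radon_measure \<mu>" and "0 < p"
    and scale: "\<And>a b t. 0 \<le> a \<Longrightarrow> 0 < t \<Longrightarrow>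
      emeasure \<mu> {a / t<..<b / t} = ennreal (t powr (- p)) * emeasure \<mu> {a<..<b}"
  shows "emeasure \<mu> {0<..<1} < \<infinity>"
proof -
  \<comment> \<open>The endpoints have ratio 4 while consecutive dilations differ by a factor 2, so
    the open intervals overlap and no endpoint is missed.\<close>
  define I where "I k = {(1/4) / 2 ^ k<..<(1::real) / 2 ^ k}" for k :: nat
  define q where "q = (2::real) powr (- p)"
  have q: "0 \<le> q" "q < 1"
    using \<open>0 < p\<close> by (auto simp: q_def powr_less_one)
  have qk: "(2 ^ k) powr (- p) = q ^ k" for k :: nat
    by (simp add: q_def powr_realpow[symmetric] powr_powr mult.commute)
  have pos: "0 < u" if "u \<in> I k" for u k
    using that by (auto simp: I_def intro: less_trans[rotated])
  have sets: "A \<in> sets \<mu>" if "A \<in> sets borel" "\<And>u. u \<in> A \<Longrightarrow> 0 < u" for A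
    using \<mu> that by (auto simp: radon_measure_def sets_restrict_space_borel_half_line)
  have I: "I k \<in> sets \<mu>" for k
    using pos by (intro sets) (auto simp: I_def)
  have "{0<..<1} \<subseteq> (\<Union>k. I k)"
  proof
    fix u :: real assume u: "u \<in> {0<..<1}"
    \<comment> \<open>The number of doublings that first brings \<open>u\<close> above 1/4. One
      doubling fewer leaves it at most 1/4, so the result is at most 1/2; without any doubling it is
      \<open>u < 1\<close>.\<close>
    define k where "k = (LEAST k. u * 2 ^ k > 1 / 4)"
    have "\<exists>k. u * 2 ^ k > 1 / 4"
    proof -
      obtain k where "1 / 4 / u < 2 ^ k"
        using real_arch_pow[of 2 "1 / 4 / u"] by auto
      then show ?thesis
        using u by (auto simp: field_simps)
    qed
    then have k: "u * 2 ^ k > 1 / 4"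
      unfolding k_def by (rule LeastI_ex)
    have "u * 2 ^ k < 1"
    proof (cases k)
      case 0
      then show ?thesis using u by simp
    next
      case (Suc j)
      then have "\<not> u * 2 ^ j > 1 / 4"
        unfolding k_def by (intro not_less_Least) (metis lessI)
      then show ?thesis
        using Suc by simp
    qed
    with k have "u \<in> I k"
      by (simp add: I_def field_simps)
    then show "u \<in> (\<Union>k. I k)" by blast
  qed
  then have "emeasure \<mu> {0<..<1} \<le> emeasure \<mu> (\<Union>k. I k)"
    using I by (intro emeasure_mono) auto
  also have "\<dots> \<le> (\<Sum>k. emeasure \<mu> (I k))"
    using I by (intro emeasure_subadditive_countably) auto
  \<comment> \<open>Scaling by \<open>t = 2 ^ k\<close> contributes the factor \<open>q ^ k\<close>,
    and \<open>q < 1\<close> because \<open>0 < p\<close>.\<close>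
  also have "\<dots> = (\<Sum>k. ennreal (q ^ k) * emeasure \<mu> (I 0))"
    using scale[of "1/4" "2 ^ k" 1 for k] by (simp add: I_def qk)
  also have "\<dots> = (\<Sum>k. ennreal (q ^ k)) * emeasure \<mu> (I 0)"
    by simp
  also have "\<dots> < \<infinity>"
  proof -
    have "(\<Sum>k. ennreal (q ^ k)) = ennreal (\<Sum>k. q ^ k)"
      using q by (intro suminf_ennreal2 summable_geometric) auto
    \<comment> \<open>The closed interval is compact in the half-line, which bounds the common
      factor of the series.\<close>
    moreover have "emeasure \<mu> (I 0) \<le> emeasure \<mu> {1/4..1}"
      by (intro emeasure_mono sets) (auto simp: I_def)
    moreover have "emeasure \<mu> {1/4..1} < \<infinity>"
      by (intro radon_measure_compact_finite[OF \<mu>]) auto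
    ultimately show ?thesis
      by (auto simp: ennreal_mult_less_top)
  qed
  finally show ?thesis .
qed

text \<open>Scaling passes from test functions to intervals and fixes the mass of every (0, b) up to
  one constant. That constant is positive because the measure is nonzero.\<close>

lemma homogeneous_radon_measure_eq_power_measure:
  assumes \<mu>: "\<mu> \<in> Obj RadMeas" and p: "0 < p"
    and sc: "\<And>\<phi> t. \<phi> \<in> Cc_half_line \<Longrightarrow> 0 < t \<Longrightarrow>
      (\<integral>u. \<phi> (t * u) \<partial>\<mu>) = t powr (- p) * (\<integral>u. \<phi> u \<partial>\<mu>)"
  shows "\<exists>c>0. \<mu> = power_measure c (p - 1)"
proof -
  have rad: "radon_measure \<mu>" and nz: "emeasure \<mu> (space \<mu>) \<noteq> 0"
    using \<mu> by (auto simp: RadMeas_def)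
  have s: "sets \<mu> = sets (restrict_space borel {0<..})"
    using rad by (simp add: radon_measure_def)
  \<comment> \<open>Both sides are limits of the same sequence of bump integrals, once scaling
    covariance is applied to each bump.\<close>
  have scale: "emeasure \<mu> {a / t<..<b / t} = ennreal (t powr (- p)) * emeasure \<mu> {a<..<b}"
    if "0 \<le> a" "0 < t" for a b t
  proof (rule LIMSEQ_unique)
    show "(\<lambda>n. ennreal (\<integral>u. Ioo_bump a b n (t * u) \<partial>\<mu>)) \<longlonglongrightarrow> emeasure \<mu> {a / t<..<b / t}"
      using emeasure_Ioo_LIMSEQ[OF rad that] .
    have "(\<lambda>n. ennreal (t powr (- p)) * ennreal (\<integral>u. Ioo_bump a b n u \<partial>\<mu>))
        \<longlonglongrightarrow> ennreal (t powr (- p)) * emeasure \<mu> {a<..<b}"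
      using emeasure_Ioo_LIMSEQ[OF rad that(1), of 1 b] by (intro ennreal_tendsto_cmult) auto
    moreover have "ennreal (\<integral>u. Ioo_bump a b n (t * u) \<partial>\<mu>)
        = ennreal (t powr (- p)) * ennreal (\<integral>u. Ioo_bump a b n u \<partial>\<mu>)" for n
      using sc[OF Ioo_bump_Cc[OF that(1)] that(2)]
      by (simp add: ennreal_mult Ioo_bump_nonneg)
    ultimately show "(\<lambda>n. ennreal (\<integral>u. Ioo_bump a b n (t * u) \<partial>\<mu>))
        \<longlonglongrightarrow> ennreal (t powr (- p)) * emeasure \<mu> {a<..<b}"
      by simp
  qed
  have "emeasure \<mu> {0<..<1} < \<infinity>"
    using homogeneous_radon_measure_finite_near_0[OF rad p scale] .
  then obtain m where m: "0 \<le> m" "emeasure \<mu> {0<..<1} = ennreal m"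
    by (cases "emeasure \<mu> {0<..<1}") auto
  \<comment> \<open>Chosen so that the power measure gives (0, 1) the mass
    \<open>c / p = m\<close>.\<close>
  define c where "c = p * m"
  \<comment> \<open>Taking \<open>t = 1 / b\<close> stretches (0, 1) to (0, b) and turns
    \<open>t powr (- p)\<close> into \<open>b powr p\<close>.\<close>
  have Ioo: "emeasure \<mu> {0<..<b} = ennreal (c / p * b powr p)" if "0 < b" for b
    using scale[of 0 "1 / b" 1] that m p
    by (simp add: c_def powr_minus powr_divide ennreal_mult mult.commute)
  have eq: "\<mu> = power_measure c (p - 1)"
  proof (rule measure_eqI_generator_eq)
    show "Int_stable (range (\<lambda>b. {0::real<..<b}))"
      by (auto simp: Int_stable_def)
    show "sets \<mu> = sigma_sets {0<..} (range (\<lambda>b. {0::real<..<b}))"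
      "sets (power_measure c (p - 1)) = sigma_sets {0<..} (range (\<lambda>b. {0::real<..<b}))"
      using s by (simp_all add: sets_half_line_generator)
    show "emeasure \<mu> X = emeasure (power_measure c (p - 1)) X"
      if X: "X \<in> range (\<lambda>b. {0::real<..<b})" for X
    proof -
      from X obtain b where b: "X = {0<..<b}" by blast
      show ?thesis
      proof (cases "0 < b")
        case True
        then show ?thesis
          using b m p by (simp add: Ioo emeasure_power_measure_Ioo c_def)
      next
        case False
        then have "X = {}" using b by auto
        then show ?thesis by simp
      qed
    qed
    \<comment> \<open>The uniqueness theorem for measures asks for an exhaustion by generators of
      finite mass. \<open>Suc n\<close> keeps the right endpoint positive, as \<open>Ioo\<close>
      requires.\<close>
    show "(\<Union>n. {0<..<real (Suc n)}) = {0<..}"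
    proof -
      have "\<exists>n. u < real (Suc n)" for u :: real
        using reals_Archimedean2[of u] by (meson less_trans lessI of_nat_less_iff)
      then show ?thesis by auto
    qed
    show "emeasure \<mu> {0<..<real (Suc n)} \<noteq> \<infinity>" for n
      by (simp add: Ioo del: of_nat_Suc)
  qed auto
  have "c \<noteq> 0"
  proof
    assume "c = 0"
    then have "emeasure \<mu> (space \<mu>) = 0"
      unfolding eq by (subst emeasure_power_measure) auto
    with nz show False by simp
  qed
  then have "0 < c"
    using m p by (auto simp: c_def)
  with eq show ?thesis by blast
qed


section \<open>Classification of the functors\<close>

lemma ae_class_cong:
  assumes "\<And>u. u \<in> space \<mu> \<Longrightarrow> h u = k u"
  shows "ae_class \<mu> h = ae_class \<mu> k"
proof -
  have "(AE u in \<mu>. l u = h u) \<longleftrightarrow> (AE u in \<mu>. l u = k u)" for l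
    using assms by (intro AE_cong) simp
  then show ?thesis
    by (simp add: ae_class_def)
qed

text \<open>Membership in a hom-set only provides some representative that transports the measure.
  This passes the property on to the explicit power density.\<close>

lemma density_from_to_ae_class_eq:
  assumes "density_from_to \<mu> \<nu> h" "pre_density \<mu> k" "ae_class \<mu> k = ae_class \<mu> h"
  shows "density_from_to \<mu> \<nu> k"
proof -
  have "AE u in \<mu>. k u = h u"
    using ae_class_self[OF assms(2)] assms(3) by (auto simp: ae_class_def)
  then have "(\<integral>\<^sup>+u\<in>B. ennreal (k u) \<partial>\<mu>) = (\<integral>\<^sup>+u\<in>B. ennreal (h u) \<partial>\<mu>)" for B
    by (intro nn_integral_cong_AE) auto
  with assms(1,2) show ?thesis
    by (simp add: density_from_to_def)
qed

lemma pre_density_powr: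
  "0 \<le> k \<Longrightarrow> pre_density (power_measure c p) (\<lambda>u. k * u powr r)"
  by (auto simp: pre_density_def borel_measurable_power_measure intro!: measurable_restrict_space1)

lemma density_from_to_power_measure:
  assumes "0 \<le> c" "0 \<le> k"
  shows "density_from_to (power_measure c p) (power_measure (k * c) (p + r)) (\<lambda>u. k * u powr r)"
  using assms by (intro density_from_toI) (simp_all add: pre_density_powr density_power_measure)

text \<open>The masses of (0, 1) are \<open>c / p\<close> and \<open>d / p\<close>.\<close>

lemma power_measure_coefficient_unique:
  assumes "0 < p" "0 < c" "0 < d" "power_measure c (p - 1) = power_measure d (p - 1)"
  shows "c = d"
proof -
  have "ennreal (c / p * 1 powr p) = ennreal (d / p * 1 powr p)"
    using assms emeasure_power_measure_Ioo[of p _ 1] by (metis less_imp_le zero_less_one)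
  then show ?thesis
    using assms by simp
qed

section \<open>From a functor to its coefficients\<close>

lemma scaling_covariant_homogeneous_imp_power:
  fixes F :: dim_functor
  assumes F: "scaling_covariant_homogeneous F" and A: "homogeneous_with F A"
  shows "\<exists>c. (\<forall>x>0. 0 < c x) \<and> (\<forall>x>0. FObj F x = power_measure (c x) (x / 2 - 1)) \<and>
    (\<forall>x>0. \<forall>r\<ge>0. A x r = c (x + 2 * r) / c x)"
proof -
  interpret cat_functor Dim_plus RadMeas F
    using F by (simp add: scaling_covariant_homogeneous_def)
  have sc: "scaling_covariant F"
    using F by (simp add: scaling_covariant_homogeneous_def)
  have obj: "FObj F x \<in> Obj RadMeas" if "0 < x" for x
    using FObj_in_Obj[of x] that by (simp add: Dim_plus_def)
  have "\<exists>c>0. FObj F x = power_measure c (x / 2 - 1)" if "0 < x" for x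
  proof -
    have "\<And>\<phi> t. \<phi> \<in> Cc_half_line \<Longrightarrow> 0 < t \<Longrightarrow>
        (\<integral>u. \<phi> (t * u) \<partial>FObj F x) = t powr (- (x / 2)) * (\<integral>u. \<phi> u \<partial>FObj F x)"
      using sc that by (simp add: scaling_covariant_def)
    then show ?thesis
      using that by (intro homogeneous_radon_measure_eq_power_measure obj) auto
  qed
  then obtain c where c: "\<And>x. 0 < x \<Longrightarrow> 0 < c x \<and> FObj F x = power_measure (c x) (x / 2 - 1)"
    by metis
  have "A x r = c (x + 2 * r) / c x" if x: "0 < x" and r: "0 \<le> r" for x r
  proof -
    let ?\<mu> = "power_measure (c x) (x / 2 - 1)" and ?y = "x + 2 * r"
    let ?\<nu> = "power_measure (c ?y) (?y / 2 - 1)" and ?h = "\<lambda>u. A x r * u powr r"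
    have y: "0 < ?y" using x r by simp
    have Apos: "0 < A x r" and mor: "FMor F x ?y r = ae_class ?\<mu> ?h"
      using A x r c by (auto simp: homogeneous_with_def)
    have "FMor F x ?y r \<in> Hom RadMeas ?\<mu> ?\<nu>"
      using FMor_in_Hom[of x ?y r] x y r c by (simp add: Dim_plus_def)
    \<comment> \<open>The representative \<open>h\<close> may differ from the power density on a
      null set.\<close>
    then obtain h where h: "density_from_to ?\<mu> ?\<nu> h" "ae_class ?\<mu> ?h = ae_class ?\<mu> h"
      unfolding mor by (auto simp: RadMeas_def)
    have "density_from_to ?\<mu> ?\<nu> ?h"
      using Apos by (intro density_from_to_ae_class_eq[OF h(1) _ h(2)] pre_density_powr) simp
    then have "?\<nu> = density ?\<mu> (\<lambda>u. ennreal (?h u))"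
      using c[OF x] c[OF y] x y
      by (intro density_from_to_eq radon_measure_power_measure) auto
    \<comment> \<open>The exponents match because
      \<open>x / 2 - 1 + r = (x + 2 * r) / 2 - 1\<close>.\<close>
    also have "\<dots> = power_measure (A x r * c x) (?y / 2 - 1)"
      using c[OF x] Apos by (subst density_power_measure) (auto simp: field_simps)
    finally have "c ?y = A x r * c x"
      using c[OF x] c[OF y] y Apos by (intro power_measure_coefficient_unique[of "?y / 2"]) auto
    then show ?thesis
      using c[OF x] by (simp add: field_simps)
  qed
  with c show ?thesis
    by blast
qed

section \<open>From coefficients to a functor\<close>

text \<open>Compatibility with composition is the telescoping of the quotients of \<open>c\<close>
  together with the addition of exponents.\<close>

lemma power_functor_cat_functor:
  assumes c: "\<And>x. 0 < x \<Longrightarrow> 0 < c x"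
  shows "cat_functor Dim_plus RadMeas (power_functor c (\<lambda>x r. c (x + 2 * r) / c x))"
proof -
  let ?A = "\<lambda>x r. c (x + 2 * r) / c x"
  let ?F = "power_functor c ?A" and ?P = "\<lambda>x. power_measure (c x) (x / 2 - 1)"
  have rad: "radon_measure (?P x)" if "0 < x" for x
    using c[OF that] that by (intro radon_measure_power_measure) auto
  have dens: "density_from_to (?P x) (?P (x + 2 * r)) (\<lambda>u. ?A x r * u powr r)"
    if "0 < x" "0 \<le> r" for x r
  proof -
    have "0 < c x" "0 < c (x + 2 * r)"
      using c that by auto
    moreover from this have "?A x r * c x = c (x + 2 * r)"
      by simp
    moreover have "(x + 2 * r) / 2 - 1 = x / 2 - 1 + r"
      by simp
    ultimately show ?thesis
      using density_from_to_power_measure[of "c x" "?A x r" "x / 2 - 1" r] by (simp only:) simp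
  qed
  have mor: "FMor ?F x y r = ae_class (?P x) (\<lambda>u. ?A x r * u powr r)"
    and obj: "FObj ?F x = ?P x" for x y r
    by (simp_all add: power_functor_def)
  show ?thesis
  proof (intro cat_functor.intro category_Dim_plus category_RadMeas cat_functor_axioms.intro)
    fix x assume "x \<in> Obj Dim_plus"
    then have x: "0 < x" by (simp add: Dim_plus_def)
    show "FObj ?F x \<in> Obj RadMeas"
      unfolding obj using x c[OF x] by (intro power_measure_in_Obj_RadMeas) auto
    \<comment> \<open>\<open>u powr 0\<close> is 1 on the half-line but 0 at \<open>u = 0\<close>,
      so the two densities are compared on the space of the measure only.\<close>
    show "FMor ?F x x (Id Dim_plus x) = Id RadMeas (FObj ?F x)"
      unfolding mor obj using c[OF x]
      by (auto simp: Dim_plus_def RadMeas_def intro!: ae_class_cong)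
  next
    fix x y r assume "x \<in> Obj Dim_plus" "r \<in> Hom Dim_plus x y"
    then show "FMor ?F x y r \<in> Hom RadMeas (FObj ?F x) (FObj ?F y)"
      unfolding mor obj using dens by (auto simp: Dim_plus_def RadMeas_def)
  next
    fix x y z r s
    assume "x \<in> Obj Dim_plus" "y \<in> Obj Dim_plus" "z \<in> Obj Dim_plus"
      "r \<in> Hom Dim_plus x y" "s \<in> Hom Dim_plus y z"
    then have x: "0 < x" and y: "0 < y" and z: "0 < z" and r: "0 \<le> r" "y = x + 2 * r"
      and s: "0 \<le> s" "z = y + 2 * s"
      by (auto simp: Dim_plus_def)
    have "Comp RadMeas (?P x) (?P y) (?P z) (ae_class (?P y) (\<lambda>u. ?A y s * u powr s))
        (ae_class (?P x) (\<lambda>u. ?A x r * u powr r))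
      = ae_class (?P x) (\<lambda>u. ?A y s * u powr s * (?A x r * u powr r))"
      using dens[OF x r(1)] dens[OF y s(1)] r(2)
      by (intro Comp_ae_class rad x y) (auto simp: density_from_to_def)
    also have "\<dots> = ae_class (?P x) (\<lambda>u. ?A x (r + s) * u powr (r + s))"
    proof (rule ae_class_cong)
      fix u
      have "?A y s * ?A x r = ?A x (r + s)"
        using c[OF x] c[OF y] r s by (simp add: algebra_simps)
      moreover have "?A y s * u powr s * (?A x r * u powr r)
          = (?A y s * ?A x r) * (u powr r * u powr s)"
        by (simp only: mult_ac)
      ultimately show "?A y s * u powr s * (?A x r * u powr r) = ?A x (r + s) * u powr (r + s)"
        by (simp only: powr_add)
    qed
    finally show "FMor ?F x z (Comp Dim_plus x y z s r)
        = Comp RadMeas (FObj ?F x) (FObj ?F y) (FObj ?F z) (FMor ?F y z s) (FMor ?F x y r)"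
      unfolding mor obj by (simp add: Dim_plus_def)
  qed
qed

lemma power_functor_scaling_covariant:
  assumes "\<And>x. 0 < x \<Longrightarrow> 0 < c x"
  shows "scaling_covariant (power_functor c A)"
  unfolding scaling_covariant_def
proof (intro allI impI ballI)
  fix x t :: real and \<phi>
  assume "0 < x" "\<phi> \<in> Cc_half_line" "0 < t"
  with integral_power_measure_scale[of \<phi> t "c x" "x / 2"] assms[of x]
  show "(\<integral>u. \<phi> (t * u) \<partial>FObj (power_functor c A) x)
      = t powr (- x / 2) * (\<integral>u. \<phi> u \<partial>FObj (power_functor c A) x)"
    by (simp add: power_functor_def Cc_half_line_measurable Cc_half_line_scale)
qed

theorem theorem4p2:
  shows "(\<forall>(F :: dim_functor) (A :: real \<Rightarrow> real \<Rightarrow> real).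
      scaling_covariant_homogeneous F \<and> homogeneous_with F A \<longrightarrow>
      (\<exists>c :: real \<Rightarrow> real. (\<forall>x>0. 0 < c x) \<and>
        (\<forall>x>0. FObj F x = power_measure (c x) (x / 2 - 1)) \<and>
        (\<forall>x>0. \<forall>r\<ge>0. A x r = c (x + 2 * r) / c x)))
    \<and> (\<forall>c :: real \<Rightarrow> real. (\<forall>x>0. 0 < c x) \<longrightarrow>
      (let A = (\<lambda>x r. c (x + 2 * r) / c x); F = power_functor c A
       in scaling_covariant_homogeneous F \<and> homogeneous_with F A))"
proof (intro conjI allI impI)
  fix F :: dim_functor and A
  assume "scaling_covariant_homogeneous F \<and> homogeneous_with F A"
  then show "\<exists>c :: real \<Rightarrow> real. (\<forall>x>0. 0 < c x) \<and>
      (\<forall>x>0. FObj F x = power_measure (c x) (x / 2 - 1)) \<and>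
      (\<forall>x>0. \<forall>r\<ge>0. A x r = c (x + 2 * r) / c x)"
    using scaling_covariant_homogeneous_imp_power by blast
next
  fix c :: "real \<Rightarrow> real" assume c: "\<forall>x>0. 0 < c x"
  then have "homogeneous_with (power_functor c (\<lambda>x r. c (x + 2 * r) / c x))
      (\<lambda>x r. c (x + 2 * r) / c x)"
    by (simp add: homogeneous_with_def power_functor_def)
  with c show "let A = (\<lambda>x r. c (x + 2 * r) / c x); F = power_functor c A
      in scaling_covariant_homogeneous F \<and> homogeneous_with F A"
    unfolding Let_def scaling_covariant_homogeneous_def
    by (blast intro: power_functor_cat_functor power_functor_scaling_covariant)
qed

end
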